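(* The cactus group $J_n$ has trivial center whenever $n>2$, and the pure cactus group $PJ_n$ has trivial center whenever $n>3$.
   Context: For $n \ge 2$, the cactus group $J_n$ is the group with generators $s_{p,q}$ for $1 \le p < q \le n$ and relations: (j1) $s_{p,q}^2 = 1$; (j2) $s_{p,q}s_{m,r} = s_{m,r}s_{p,q}$ whenever $[p,q]\cap[m,r]=\emptyset$; (j3) $s_{p,q}s_{m,r} = s_{p+q-r,\,p+q-m}\,s_{p,q}$ whenever $[m,r]\subset[p,q]$. There is a homomorphism $s\colon J_n\to S_n$ sending $s_{p,q}$ to the permutation of $\{1,\dots,n\}$ that reverses the order of $p,p+1,\dots,q$ and fixes all other elements. The pure cactus group $PJ_n$ is the kernel of $s$. *)

theory Defs
  imports "HOL-Algebra.Sym_Groups"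
begin

section \<open>Groups given by generators and relations\<close>

text \<open>
  The letter \<open>(x, True)\<close> stands for the generator \<open>x\<close> and \<open>(x, False)\<close> for its formal
  inverse. A pair \<open>(l, r)\<close> of words in \<open>R\<close> stands for the relation \<open>l = r\<close>.
\<close>

type_synonym 'a word = "('a \<times> bool) list"

definition words :: "'a set \<Rightarrow> 'a word set" where
  "words X = lists (X \<times> UNIV)"

inductive word_eq :: "'a set \<Rightarrow> ('a word \<times> 'a word) set \<Rightarrow> 'a word \<Rightarrow> 'a word \<Rightarrow> bool"
  for X :: "'a set" and R :: "('a word \<times> 'a word) set" where
  refl: "w \<in> words X \<Longrightarrow> word_eq X R w w"
| sym: "word_eq X R u v \<Longrightarrow> word_eq X R v u"
| trans: "word_eq X R u v \<Longrightarrow> word_eq X R v w \<Longrightarrow> word_eq X R u w"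
| cancel: "x \<in> X \<Longrightarrow> u \<in> words X \<Longrightarrow> v \<in> words X \<Longrightarrow>
    word_eq X R (u @ [(x, b), (x, \<not> b)] @ v) (u @ v)"
| rel: "(l, r) \<in> R \<Longrightarrow> u @ l @ v \<in> words X \<Longrightarrow> u @ r @ v \<in> words X \<Longrightarrow>
    word_eq X R (u @ l @ v) (u @ r @ v)"

definition word_rel :: "'a set \<Rightarrow> ('a word \<times> 'a word) set \<Rightarrow> ('a word \<times> 'a word) set" where
  "word_rel X R = {(u, v). word_eq X R u v}"

definition presented_group ::
    "'a set \<Rightarrow> ('a word \<times> 'a word) set \<Rightarrow> 'a word set monoid" where
  "presented_group X R = \<lparr>
     carrier = words X // word_rel X R,
     mult = (\<lambda>A B. \<Union>u\<in>A. \<Union>v\<in>B. word_rel X R `` {u @ v}),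
     one = word_rel X R `` {[]} \<rparr>"

primrec word_eval :: "('b, 'm) monoid_scheme \<Rightarrow> ('a \<Rightarrow> 'b) \<Rightarrow> 'a word \<Rightarrow> 'b" where
  "word_eval H f [] = \<one>\<^bsub>H\<^esub>"
| "word_eval H f (a # w) =
     (if snd a then f (fst a) else inv\<^bsub>H\<^esub> (f (fst a))) \<otimes>\<^bsub>H\<^esub> word_eval H f w"

text \<open>
  The homomorphism out of a presented group that extends a map \<open>f\<close> on the generators. It is
  meaningful only if \<open>f\<close> respects the relations, for then \<open>word_eval H f\<close> is constant on
  each class (see \<open>presented_hom_in_hom\<close> below).
\<close>

definition presented_hom ::
    "('b, 'm) monoid_scheme \<Rightarrow> ('a \<Rightarrow> 'b) \<Rightarrow> 'a word set \<Rightarrow> 'b" where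
  "presented_hom H f A = the_elem (word_eval H f ` A)"


section \<open>Cactus groups\<close>

definition cactus_gens :: "nat \<Rightarrow> (nat \<times> nat) set" where
  "cactus_gens n = {(p, q). 1 \<le> p \<and> p < q \<and> q \<le> n}"

abbreviation sgen :: "nat \<Rightarrow> nat \<Rightarrow> (nat \<times> nat) word" where
  "sgen p q \<equiv> [((p, q), True)]"

definition cactus_rels :: "nat \<Rightarrow> ((nat \<times> nat) word \<times> (nat \<times> nat) word) set" where
  "cactus_rels n =
     {(sgen p q @ sgen p q, []) | p q. (p, q) \<in> cactus_gens n} \<union>
     {(sgen p q @ sgen m r, sgen m r @ sgen p q) | p q m r.
        (p, q) \<in> cactus_gens n \<and> (m, r) \<in> cactus_gens n \<and> {p..q} \<inter> {m..r} = {}} \<union>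
     {(sgen p q @ sgen m r, sgen (p + q - r) (p + q - m) @ sgen p q) | p q m r.
        (p, q) \<in> cactus_gens n \<and> (m, r) \<in> cactus_gens n \<and> {m..r} \<subseteq> {p..q}}"

definition cactus_group :: "nat \<Rightarrow> (nat \<times> nat) word set monoid" where
  "cactus_group n = presented_group (cactus_gens n) (cactus_rels n)"

definition reversal :: "nat \<Rightarrow> nat \<Rightarrow> nat \<Rightarrow> nat" where
  "reversal p q i = (if i \<in> {p..q} then p + q - i else i)"

definition cactus_perm :: "nat \<Rightarrow> (nat \<times> nat) word set \<Rightarrow> nat \<Rightarrow> nat" where
  "cactus_perm n = presented_hom (sym_group n) (\<lambda>(p, q). reversal p q)"

definition pure_cactus_group :: "nat \<Rightarrow> (nat \<times> nat) word set monoid" where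
  "pure_cactus_group n =
     (cactus_group n)\<lparr>carrier := kernel (cactus_group n) (sym_group n) (cactus_perm n)\<rparr>"

definition center :: "('a, 'm) monoid_scheme \<Rightarrow> 'a set" where
  "center G = {z \<in> carrier G. \<forall>g\<in>carrier G. z \<otimes>\<^bsub>G\<^esub> g = g \<otimes>\<^bsub>G\<^esub> z}"


section \<open>Well-definedness\<close>

lemma words_Nil [simp]: "[] \<in> words X"
  and words_Cons [simp]: "a # w \<in> words X \<longleftrightarrow> fst a \<in> X \<and> w \<in> words X"
  and words_append [simp]: "u @ v \<in> words X \<longleftrightarrow> u \<in> words X \<and> v \<in> words X"
  by (cases a; auto simp: words_def)+

lemma word_eq_words:
  assumes "word_eq X R u v"
  shows "u \<in> words X \<and> v \<in> words X"
  using assms by induction auto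

lemma equiv_word_rel: "equiv (words X) (word_rel X R)"
  by (rule equivI)
    (auto simp: word_rel_def refl_on_def sym_def trans_def
      intro: word_eq.intros dest: word_eq_words)

lemma word_eq_append_left:
  assumes "word_eq X R u v" "w \<in> words X"
  shows "word_eq X R (w @ u) (w @ v)"
  using assms
proof induction
  case (cancel x u v b)
  then show ?case using word_eq.cancel[of x X "w @ u" v R b] by simp
next
  case (rel l r u v)
  then show ?case using word_eq.rel[of l r R "w @ u" v X] by simp
qed (auto intro: word_eq.intros)

lemma word_eq_append_right:
  assumes "word_eq X R u v" "w \<in> words X"
  shows "word_eq X R (u @ w) (v @ w)"
  using assms
proof induction
  case (cancel x u v b)
  then show ?case using word_eq.cancel[of x X u "v @ w" R b] by simp
next
  case (rel l r u v)
  then show ?case using word_eq.rel[of l r R u "v @ w" X] by simp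
qed (auto intro: word_eq.intros)

lemma word_eq_append:
  assumes "word_eq X R u u'" "word_eq X R v v'"
  shows "word_eq X R (u @ v) (u' @ v')"
  using assms word_eq_append_left word_eq_append_right word_eq_words word_eq.trans by metis

lemma class_eq_iff:
  assumes "u \<in> words X" "v \<in> words X"
  shows "word_rel X R `` {u} = word_rel X R `` {v} \<longleftrightarrow> word_eq X R u v"
  using eq_equiv_class_iff[OF equiv_word_rel assms, of R] by (simp add: word_rel_def)

lemma presented_mult:
  assumes "u \<in> words X" "v \<in> words X"
  shows "word_rel X R `` {u} \<otimes>\<^bsub>presented_group X R\<^esub> word_rel X R `` {v}
    = word_rel X R `` {u @ v}"
proof -
  have "(\<lambda>u v. word_rel X R `` {u @ v}) respects2 word_rel X R"
  proof (rule congruent2I')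
    fix u u' v v' assume "(u, u') \<in> word_rel X R" "(v, v') \<in> word_rel X R"
    then have *: "word_eq X R u u'" "word_eq X R v v'" by (simp_all add: word_rel_def)
    show "word_rel X R `` {u @ v} = word_rel X R `` {u' @ v'}"
      using word_eq_append[OF *] word_eq_words[OF *(1)] word_eq_words[OF *(2)]
      by (simp add: class_eq_iff)
  qed
  from UN_equiv_class2[OF equiv_word_rel equiv_word_rel this assms] show ?thesis
    by (simp add: presented_group_def)
qed

lemma presented_carrierE:
  assumes "A \<in> carrier (presented_group X R)"
  obtains w where "w \<in> words X" "A = word_rel X R `` {w}"
  using assms by (auto simp: presented_group_def elim: quotientE)

lemma presented_carrierI: "w \<in> words X \<Longrightarrow> word_rel X R `` {w} \<in> carrier (presented_group X R)"
  by (simp add: presented_group_def quotientI)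

lemma presented_one: "\<one>\<^bsub>presented_group X R\<^esub> = word_rel X R `` {[]}"
  by (simp add: presented_group_def)

definition word_inv :: "'a word \<Rightarrow> 'a word" where
  "word_inv w = rev (map (apsnd Not) w)"

lemma word_inv_words: "w \<in> words X \<Longrightarrow> word_inv w \<in> words X"
  by (induction w) (auto simp: word_inv_def)

lemma word_inv_cancel: "w \<in> words X \<Longrightarrow> word_eq X R (word_inv w @ w) []"
proof (induction w)
  case Nil
  then show ?case by (simp add: word_inv_def word_eq.refl)
next
  case (Cons a w)
  obtain x b where a: "a = (x, b)" by (cases a)
  have "word_eq X R (word_inv w @ [(x, \<not> b), (x, \<not> \<not> b)] @ w) (word_inv w @ w)"
    using Cons a by (intro word_eq.cancel) (auto intro: word_inv_words)
  then have "word_eq X R (word_inv (a # w) @ a # w) (word_inv w @ w)"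
    by (simp add: word_inv_def a)
  with Cons show ?case by (auto intro: word_eq.trans)
qed

lemma presented_group_is_group: "group (presented_group X R)"
proof (rule groupI)
  fix A assume "A \<in> carrier (presented_group X R)"
  then obtain w where w: "w \<in> words X" "A = word_rel X R `` {w}" by (rule presented_carrierE)
  show "\<exists>B\<in>carrier (presented_group X R). B \<otimes>\<^bsub>presented_group X R\<^esub> A = \<one>\<^bsub>presented_group X R\<^esub>"
    using w by (intro bexI[of _ "word_rel X R `` {word_inv w}"])
      (auto simp: presented_mult presented_one class_eq_iff word_inv_words word_inv_cancel
        intro: presented_carrierI)
qed (auto simp: presented_mult presented_one intro!: presented_carrierI elim!: presented_carrierE)

lemma presented_relation:
  assumes "(l, r) \<in> R" "l \<in> words X" "r \<in> words X"
  shows "word_rel X R `` {l} = word_rel X R `` {r}"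
  using word_eq.rel[of l r R "[]" "[]" X] assms by (simp add: class_eq_iff)

context
  fixes X :: "'a set" and R :: "('a word \<times> 'a word) set"
    and H :: "('b, 'm) monoid_scheme" and f :: "'a \<Rightarrow> 'b"
  assumes H: "group H"
    and f: "f ` X \<subseteq> carrier H"
    and R: "\<And>l r. (l, r) \<in> R \<Longrightarrow> l \<in> words X \<Longrightarrow> r \<in> words X \<Longrightarrow> word_eval H f l = word_eval H f r"
begin

interpretation H: group H by (rule H)

lemma word_eval_closed: "w \<in> words X \<Longrightarrow> word_eval H f w \<in> carrier H"
  using f by (induction w) auto

lemma word_eval_append:
  "u \<in> words X \<Longrightarrow> v \<in> words X \<Longrightarrow>
    word_eval H f (u @ v) = word_eval H f u \<otimes>\<^bsub>H\<^esub> word_eval H f v"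
proof (induction u)
  case (Cons a u)
  then have "f (fst a) \<in> carrier H" using f by auto
  with Cons show ?case by (auto simp: H.m_assoc word_eval_closed)
qed (simp add: word_eval_closed)

lemma word_eval_cong:
  assumes "word_eq X R u v"
  shows "word_eval H f u = word_eval H f v"
  using assms
proof induction
  case (cancel x u v b)
  then have "f x \<in> carrier H" using f by auto
  with cancel show ?case
    by (cases b) (simp_all add: word_eval_append word_eval_closed H.inv_solve_left' flip: H.m_assoc)
next
  case (rel l r u v)
  then show ?case by (simp add: word_eval_append R)
qed auto

lemma presented_hom_class:
  assumes "w \<in> words X"
  shows "presented_hom H f (word_rel X R `` {w}) = word_eval H f w"
proof -
  have "word_eval H f ` (word_rel X R `` {w}) = {word_eval H f w}"
    using assms by (auto simp: word_rel_def image_iff intro: word_eq.refl dest: word_eval_cong)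
  then show ?thesis by (simp add: presented_hom_def)
qed

lemma presented_hom_in_hom: "presented_hom H f \<in> hom (presented_group X R) H"
  by (rule homI)
    (auto simp: presented_mult presented_hom_class word_eval_append
      intro: word_eval_closed elim!: presented_carrierE)

lemma presented_hom_gen:
  "x \<in> X \<Longrightarrow> presented_hom H f (word_rel X R `` {[(x, True)]}) = f x"
  using f by (auto simp: presented_hom_class)

end

lemma cactus_rels_words: "(l, r) \<in> cactus_rels n \<Longrightarrow> l \<in> words (cactus_gens n) \<and> r \<in> words (cactus_gens n)"
  by (fastforce simp: cactus_rels_def cactus_gens_def)

lemma cactus_group_is_group: "group (cactus_group n)"
  by (simp add: cactus_group_def presented_group_is_group)

lemma reversal_permutes:
  assumes "(p, q) \<in> cactus_gens n"
  shows "reversal p q permutes {1..n}"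
proof (rule bij_imp_permutes)
  show "bij_betw (reversal p q) {1..n} {1..n}"
    using assms
    by (intro bij_betwI[where g = "reversal p q"]) (auto simp: reversal_def cactus_gens_def)
  show "reversal p q i = i" if "i \<notin> {1..n}" for i
    using that assms by (auto simp: reversal_def cactus_gens_def)
qed

lemma reversal_in_sym_group:
  "(\<lambda>(p, q). reversal p q) ` cactus_gens n \<subseteq> carrier (sym_group n)"
proof clarify
  fix p q assume "(p, q) \<in> cactus_gens n"
  then show "reversal p q \<in> carrier (sym_group n)"
    unfolding sym_group_carrier by (rule reversal_permutes)
qed

lemma reversal_respects_cactus_rels:
  assumes "(l, r) \<in> cactus_rels n"
  shows "word_eval (sym_group n) (\<lambda>(p, q). reversal p q) l
    = word_eval (sym_group n) (\<lambda>(p, q). reversal p q) r"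
proof -
  have j1: "reversal p q \<circ> reversal p q = id" for p q
    by (auto simp: fun_eq_iff reversal_def)
  have j2: "reversal p q \<circ> reversal m r = reversal m r \<circ> reversal p q"
    if "{p..q} \<inter> {m..r} = {}" for p q m r
  proof
    fix i
    have disj: "j \<notin> {p..q} \<or> j \<notin> {m..r}" for j using that by blast
    have inv: "p + q - j \<in> {p..q}" if "j \<in> {p..q}" for p q j :: nat
      using that by auto
    show "(reversal p q \<circ> reversal m r) i = (reversal m r \<circ> reversal p q) i"
    proof (cases "i \<in> {p..q}")
      case True
      then have "i \<notin> {m..r}" "p + q - i \<notin> {m..r}" using disj inv by blast+
      with True show ?thesis by (simp add: reversal_def del: atLeastAtMost_iff)
    next
      case False
      show ?thesis
      proof (cases "i \<in> {m..r}")
        case True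
        then have "m + r - i \<notin> {p..q}" using disj inv by blast
        with True False show ?thesis by (simp add: reversal_def del: atLeastAtMost_iff)
      qed (use False in \<open>simp add: reversal_def del: atLeastAtMost_iff\<close>)
    qed
  qed
  have j3: "reversal p q \<circ> reversal m r = reversal (p + q - r) (p + q - m) \<circ> reversal p q"
    if "(m, r) \<in> cactus_gens n" "{m..r} \<subseteq> {p..q}" for p q m r
  proof -
    from that have "p \<le> m" "m < r" "r \<le> q" by (auto simp: cactus_gens_def)
    then show ?thesis by (auto simp: fun_eq_iff reversal_def)
  qed
  show ?thesis
    using assms j1 j2 j3 by (auto simp: cactus_rels_def sym_group_mult sym_group_one)
qed

lemma cactus_perm_hom: "cactus_perm n \<in> hom (cactus_group n) (sym_group n)"
  unfolding cactus_perm_def cactus_group_def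
  by (rule presented_hom_in_hom[OF sym_group_is_group reversal_in_sym_group
        reversal_respects_cactus_rels])

lemma cactus_perm_gen:
  assumes "(p, q) \<in> cactus_gens n"
  shows "cactus_perm n (word_rel (cactus_gens n) (cactus_rels n) `` {sgen p q}) = reversal p q"
  unfolding cactus_perm_def
  using presented_hom_gen[OF sym_group_is_group reversal_in_sym_group
      reversal_respects_cactus_rels assms] by simp

lemma pure_cactus_group_is_group: "group (pure_cactus_group n)"
proof -
  interpret group_hom "cactus_group n" "sym_group n" "cactus_perm n"
    by (intro group_hom.intro group_hom_axioms.intro
        cactus_group_is_group sym_group_is_group cactus_perm_hom)
  show ?thesis
    unfolding pure_cactus_group_def by (rule subgroup.subgroup_is_group[OF subgroup_kernel]) simp
qed

end

theory Submission
  imports Defs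
begin

text \<open>
  A cactus word is read as a sequence of moves on a row of items, each of which reverses the items
  in an interval of positions; its letters are the sets of items that are reversed. Let \<open>W\<close> be the
  right-angled Coxeter group generated by the subsets of \<open>{1..n}\<close>, where two sets commute if they
  are disjoint or nested. The relations of the cactus group correspond exactly to the
  commutations and cancellations of letters, so a shortest word of an element has letters that form
  a reduced word of \<open>W\<close>, and the pure cactus group embeds into \<open>W\<close>.

  Let \<open>d \<in> W\<close> come from a central element. The powers of \<open>s\<^bsub>1,n-1\<^esub> s\<^bsub>2,n\<^esub>\<close> have letters
  \<open>N - {n}, N - {n-1}, \<dots>\<close> with \<open>N = {1..n}\<close>, no two neighbours of which commute. If \<open>d\<close>
  commutes with a long word \<open>e\<close> of this kind, then \<open>de\<close> is reduced (or is so for the reverse of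
  \<open>e\<close>), hence starts with every letter with which \<open>d\<close> can start, whereas \<open>ed\<close> can only start with
  the first letter of \<open>e\<close> or with letters that commute with all of \<open>e\<close>. So \<open>d\<close> can start only with
  \<open>N - {n}\<close>, \<open>N - {1}\<close> or \<open>N\<close>. The first two are excluded by the same argument in blocks of three
  positions if \<open>n > 3\<close>, and by commutation with \<open>s\<^bsub>1,n\<^esub>\<close> in the whole cactus group. Since \<open>N\<close>
  commutes with everything, \<open>d\<close> is trivial or \<open>N\<close>, and \<open>s\<^bsub>1,n\<^esub>\<close> is not pure.
\<close>

section \<open>Reduced words in right-angled Coxeter groups\<close>

locale right_angled =
  fixes comm :: "'a \<Rightarrow> 'a \<Rightarrow> bool"
  assumes comm_sym: "comm a b \<Longrightarrow> comm b a"
    and comm_irrefl: "\<not> comm a a"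
begin

section \<open>Words up to commutation, and the generators acting on them\<close>

inductive trace_eq :: "'a list \<Rightarrow> 'a list \<Rightarrow> bool" (infix "\<approx>" 50) where
  trace_refl: "w \<approx> w"
| trace_swap: "comm a b \<Longrightarrow> a # b # w \<approx> b # a # w"
| trace_Cons: "u \<approx> v \<Longrightarrow> a # u \<approx> a # v"
| trace_trans [trans]: "u \<approx> v \<Longrightarrow> v \<approx> w \<Longrightarrow> u \<approx> w"

declare trace_refl [simp, intro]

lemma trace_sym: "u \<approx> v \<Longrightarrow> v \<approx> u"
  by (induction rule: trace_eq.induct) (auto intro: trace_eq.intros comm_sym)

text \<open>For a reduced word \<open>w\<close>, these letters are the left descents of its group
  element.\<close>

primrec avail :: "'a \<Rightarrow> 'a list \<Rightarrow> bool" where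
  "avail a [] = False"
| "avail a (b # w) = (b = a \<or> comm a b \<and> avail a w)"

text \<open>The solution of the word problem in right-angled Coxeter groups serves as the
  definition: a word fails to be shortest exactly if commutations can bring two equal letters
  together.\<close>

primrec reduced :: "'a list \<Rightarrow> bool" where
  "reduced [] = True"
| "reduced (a # w) = (\<not> avail a w \<and> reduced w)"

text \<open>Left multiplication by a generator. The group itself is never built: by
  \<open>act_act\<close> and \<open>act_commute\<close> it acts on reduced words up to
  \<open>trace_eq\<close>, and \<open>foldr act w []\<close> is a reduced form of
  \<open>w\<close>.\<close>

definition act :: "'a \<Rightarrow> 'a list \<Rightarrow> 'a list" where
  "act a w = (if avail a w then remove1 a w else a # w)"

lemma trace_avail: "u \<approx> v \<Longrightarrow> avail a u = avail a v"
  by (induction rule: trace_eq.induct) (auto intro: comm_sym simp: comm_irrefl)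

lemma trace_reduced: "u \<approx> v \<Longrightarrow> reduced u = reduced v"
  by (induction rule: trace_eq.induct) (auto intro: comm_sym simp: comm_irrefl trace_avail)

lemma trace_length: "u \<approx> v \<Longrightarrow> length u = length v"
  by (induction rule: trace_eq.induct) auto

lemma trace_remove1: "u \<approx> v \<Longrightarrow> remove1 a u \<approx> remove1 a v"
  by (induction rule: trace_eq.induct) (auto intro: trace_eq.intros)

lemma avail_trace: "avail a w \<Longrightarrow> w \<approx> a # remove1 a w"
proof (induction w)
  case (Cons b w)
  show ?case
  proof (cases "b = a")
    case False
    with Cons have *: "comm a b" "w \<approx> a # remove1 a w" by auto
    have "b # w \<approx> b # a # remove1 a w" using * by (auto intro: trace_eq.intros)
    also have "\<dots> \<approx> a # b # remove1 a w" using * by (auto intro: trace_eq.intros comm_sym)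
    finally show ?thesis using False by simp
  qed simp
qed simp

lemma avail_comm: "avail a w \<Longrightarrow> avail b w \<Longrightarrow> a \<noteq> b \<Longrightarrow> comm a b"
  by (induction w) (auto intro: comm_sym)

lemma avail_append: "avail a (u @ v) \<longleftrightarrow> avail a u \<or> (\<forall>b\<in>set u. comm a b) \<and> avail a v"
  by (induction u) auto

lemma act_cong: "u \<approx> v \<Longrightarrow> act a u \<approx> act a v"
  by (auto simp: act_def trace_avail intro: trace_remove1 trace_Cons)

lemma reduced_remove1: "reduced w \<Longrightarrow> avail a w \<Longrightarrow> reduced (a # remove1 a w)"
  using trace_reduced[OF avail_trace] by blast

lemma reduced_act: "reduced w \<Longrightarrow> reduced (act a w)"
  using reduced_remove1 by (auto simp: act_def)

lemma act_act: "reduced w \<Longrightarrow> act a (act a w) \<approx> w"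
  using reduced_remove1[of w a] trace_sym[OF avail_trace[of a w]] by (auto simp: act_def)

lemma avail_act: "comm a b \<Longrightarrow> avail a (act b w) = avail a w"
  using trace_avail[OF avail_trace[of b w], of a] by (auto simp: act_def comm_irrefl)

lemma act_commute:
  assumes "comm a b"
  shows "act a (act b w) \<approx> act b (act a w)"
proof -
  have "a \<noteq> b" "comm b a" using assms comm_irrefl comm_sym by auto
  then show ?thesis
    using avail_act[OF assms, of w] avail_act[OF \<open>comm b a\<close>, of w] assms
    by (auto simp: act_def remove1_commute intro: trace_eq.intros)
qed

lemma foldr_act_cong: "u \<approx> v \<Longrightarrow> foldr act w u \<approx> foldr act w v"
  by (induction w) (auto intro: act_cong)

lemma reduced_foldr_act: "reduced u \<Longrightarrow> reduced (foldr act w u)"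
  by (induction w) (auto intro: reduced_act)

lemma foldr_act_reduced: "reduced w \<Longrightarrow> foldr act w [] = w"
  by (induction w) (auto simp: act_def)

lemma foldr_act_commute:
  assumes "\<forall>b\<in>set w. b = a \<or> comm a b"
  shows "foldr act w (act a u) \<approx> act a (foldr act w u)"
  using assms
proof (induction w)
  case (Cons b w)
  then have "act b (foldr act w (act a u)) \<approx> act b (act a (foldr act w u))"
    by (auto intro: act_cong)
  also have "\<dots> \<approx> act a (act b (foldr act w u))"
    using Cons.prems by (auto intro: act_commute comm_sym)
  finally show ?case by simp
qed simp

text \<open>In a chain no two neighbours commute or cancel, so only its first letter can be moved to the
  front.\<close>

abbreviation chain :: "'a list \<Rightarrow> bool" where
  "chain \<equiv> successively (\<lambda>a b. a \<noteq> b \<and> \<not> comm a b)"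

lemma avail_chain: "chain w \<Longrightarrow> avail a w \<longleftrightarrow> w \<noteq> [] \<and> a = hd w"
  by (induction w) (auto simp: successively_Cons dest: comm_sym)

lemma reduced_chain: "chain w \<Longrightarrow> reduced w"
  by (induction w) (auto simp: successively_Cons avail_chain)

text \<open>A letter of \<open>d\<close> could cancel only against \<open>hd e\<close>, the one
  letter that can leave the front of \<open>e\<close>. It would commute with all later letters of
  \<open>d\<close>, so \<open>d\<close> could end with \<open>hd e\<close>.\<close>

lemma reduced_append_chain:
  assumes "reduced d" "chain e" "e \<noteq> []" "\<not> avail (hd e) (rev d)"
  shows "reduced (d @ e)"
  using assms
proof (induction d)
  case (Cons a d)
  then show ?case by (auto simp: avail_append avail_chain)
qed (simp add: reduced_chain)

lemma reduced_snoc: "reduced (w @ [a]) \<longleftrightarrow> reduced w \<and> \<not> avail a (rev w)"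
  by (induction w) (auto simp: avail_append)

lemma reduced_rev: "reduced w \<Longrightarrow> reduced (rev w)"
  by (induction w) (auto simp: reduced_snoc)

lemma avail_in_set: "avail a w \<Longrightarrow> a \<in> set w"
  by (induction w) auto

text \<open>Multiplying by the letters of a chain from its end first cancels and, once it has failed to
  cancel, never cancels again.\<close>

lemma foldr_act_chain_cases:
  assumes "chain e"
  shows "length (foldr act e d) + length e = length d \<or> e \<noteq> [] \<and> avail (hd e) (foldr act e d)"
  using assms
proof (induction e)
  case (Cons c e)
  let ?r = "foldr act e d"
  have e: "chain e" using Cons.prems by (auto simp: successively_Cons)
  show ?case
  proof (cases "avail c ?r")
    case True
    have False if "e \<noteq> []" "avail (hd e) ?r"
      using avail_comm[OF True that(2)] that(1) Cons.prems by (auto simp: successively_Cons)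
    with Cons.IH[OF e] have "length ?r + length e = length d" by blast
    moreover have "length (remove1 c ?r) + 1 = length ?r"
      using trace_length[OF avail_trace[OF True]] by simp
    ultimately show ?thesis using True by (simp add: act_def[of c])
  qed (simp add: act_def[of c])
qed simp

text \<open>As \<open>e2\<close> is longer than \<open>d\<close>, the first case of
  \<open>foldr_act_chain_cases\<close> is impossible. So every letter of \<open>e1\<close> meets an
  available neighbour with which it neither commutes nor cancels, and is simply put in
  front.\<close>

lemma foldr_act_chain_append:
  assumes "chain (e1 @ e2)" "length d < length e2"
  shows "foldr act (e1 @ e2) d = e1 @ foldr act e2 d"
  using assms
proof (induction e1)
  case (Cons c e1)
  let ?e = "e1 @ e2"
  have ne: "?e \<noteq> []" using Cons.prems by auto
  have *: "chain ?e" "c \<noteq> hd ?e" "\<not> comm c (hd ?e)"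
    using Cons.prems ne by (auto simp: successively_Cons)
  have "avail (hd ?e) (foldr act ?e d)"
    using foldr_act_chain_cases[OF *(1), of d] Cons.prems by auto
  then have "\<not> avail c (foldr act ?e d)"
    using avail_comm * by blast
  then show ?case using Cons.IH[OF *(1)] Cons.prems by (simp add: act_def[of c])
qed simp

text \<open>The part \<open>e2\<close> absorbs all cancellation against \<open>d\<close>, so
  \<open>e1\<close> survives at the front of the second product. The first product is reduced, so
  every letter that can start \<open>d\<close> can start both products.\<close>

lemma avail_commuting_chain:
  assumes "reduced d" "chain (e1 @ e2)" "e1 \<noteq> []" "length d < length e2"
    and last: "\<not> avail (hd e1) (rev d)"
    and commute: "foldr act (d @ e1 @ e2) [] \<approx> foldr act ((e1 @ e2) @ d) []"
    and "avail a d"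
  shows "a = hd e1 \<or> (\<forall>b\<in>set e1. comm a b)"
proof -
  have "reduced (d @ e1 @ e2)"
    using assms by (intro reduced_append_chain) auto
  then have "foldr act (d @ e1 @ e2) [] = d @ e1 @ e2"
    by (rule foldr_act_reduced)
  moreover have "foldr act ((e1 @ e2) @ d) [] = e1 @ foldr act e2 d"
    using foldr_act_chain_append[OF assms(2,4)] assms(1) by (simp add: foldr_act_reduced)
  ultimately have "avail a (e1 @ foldr act e2 d)"
    using commute trace_avail[of _ _ a] \<open>avail a d\<close> by (metis avail_append)
  moreover have "chain e1" using assms(2) by (simp add: successively_append_iff)
  ultimately show ?thesis by (auto simp: avail_append avail_chain)
qed

end


section \<open>Letters of a cactus word\<close>

definition compatible :: "'a set \<Rightarrow> 'a set \<Rightarrow> bool" where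
  "compatible A B \<longleftrightarrow> A \<noteq> B \<and> (A \<inter> B = {} \<or> A \<subseteq> B \<or> B \<subseteq> A)"

interpretation right_angled "compatible :: nat set \<Rightarrow> nat set \<Rightarrow> bool"
  by unfold_locales (auto simp: compatible_def)

lemma compatible_image: "inj f \<Longrightarrow> compatible (f ` A) (f ` B) = compatible A B"
  unfolding compatible_def
  by (simp add: inj_image_eq_iff inj_image_subset_iff flip: image_Int)

abbreviation gen_interval :: "nat \<times> nat \<Rightarrow> nat set" where
  "gen_interval x \<equiv> {fst x..snd x}"

abbreviation gen_perm :: "nat \<times> nat \<Rightarrow> nat \<Rightarrow> nat" where
  "gen_perm x \<equiv> reversal (fst x) (snd x)"

primrec list_perm :: "(nat \<times> nat) list \<Rightarrow> nat \<Rightarrow> nat" where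
  "list_perm [] = id"
| "list_perm (x # w) = gen_perm x \<circ> list_perm w"

text \<open>The letter of an entry is the set of items reversed by it, where \<open>f i\<close> is the item in
  position \<open>i\<close> at the start.\<close>

primrec letters :: "(nat \<Rightarrow> nat) \<Rightarrow> (nat \<times> nat) list \<Rightarrow> nat set list" where
  "letters f [] = []"
| "letters f (x # w) = f ` gen_interval x # letters (f \<circ> gen_perm x) w"

lemma reversal_reversal [simp]: "reversal p q (reversal p q i) = i"
  by (auto simp: reversal_def)

lemma reversal_comp_reversal [simp]: "reversal p q \<circ> reversal p q = id"
  by auto

lemma inj_reversal [simp]: "inj (reversal p q)"
  by (metis injI reversal_reversal)

lemma reversal_image_inside:
  assumes "p \<le> m" "m \<le> r" "r \<le> q"
  shows "reversal p q ` {m..r} = {p + q - r..p + q - m}"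
proof
  show "reversal p q ` {m..r} \<subseteq> {p + q - r..p + q - m}"
    using assms by (auto simp: reversal_def)
  show "{p + q - r..p + q - m} \<subseteq> reversal p q ` {m..r}"
  proof
    fix i assume "i \<in> {p + q - r..p + q - m}"
    then have "i = reversal p q (p + q - i)" "p + q - i \<in> {m..r}"
      using assms by (auto simp: reversal_def)
    then show "i \<in> reversal p q ` {m..r}" by blast
  qed
qed

lemma reversal_image_invariant:
  assumes "\<And>i. i \<in> A \<Longrightarrow> reversal p q i \<in> A"
  shows "reversal p q ` A = A"
proof
  show "A \<subseteq> reversal p q ` A"
    using assms by (metis image_eqI reversal_reversal subsetI)
qed (use assms in auto)

lemma reversal_image_outside:
  "{p..q} \<subseteq> A \<or> {p..q} \<inter> A = {} \<Longrightarrow> reversal p q ` A = A"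
proof (rule reversal_image_invariant)
  fix i assume *: "{p..q} \<subseteq> A \<or> {p..q} \<inter> A = {}" "i \<in> A"
  show "reversal p q i \<in> A"
  proof (cases "i \<in> {p..q}")
    case True
    then have "p + q - i \<in> {p..q}" by auto
    with True * show ?thesis by (auto simp: reversal_def)
  qed (use * in \<open>auto simp: reversal_def\<close>)
qed

lemma inj_comp [simp]: "inj f \<Longrightarrow> inj g \<Longrightarrow> inj (f \<circ> g)"
  by (rule inj_compose)

lemma inj_list_perm [simp]: "inj (list_perm w)"
proof (induction w)
  case (Cons x w)
  then show ?case unfolding list_perm.simps by (intro inj_comp inj_reversal)
qed simp

lemma list_perm_append: "list_perm (u @ v) = list_perm u \<circ> list_perm v"
  by (induction u) (simp_all add: comp_assoc)

lemma list_perm_rev: "list_perm w \<circ> list_perm (rev w) = id"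
proof (induction w)
  case (Cons x w)
  have "list_perm (x # w) \<circ> list_perm (rev (x # w))
    = gen_perm x \<circ> (list_perm w \<circ> list_perm (rev w)) \<circ> gen_perm x"
    by (simp add: list_perm_append comp_assoc)
  then show ?case by (simp only: Cons.IH) simp
qed simp

lemma letters_append: "letters f (u @ v) = letters f u @ letters (f \<circ> list_perm u) v"
  by (induction u arbitrary: f) (simp_all add: comp_assoc)

lemma length_letters [simp]: "length (letters f w) = length w"
  by (induction w arbitrary: f) auto

text \<open>This congruence rule unfolds compositions under images.\<close>

declare image_cong_simp [cong del]

lemma image_comp_reversal: "(f \<circ> reversal p q) ` A = f ` reversal p q ` A"
  by (simp only: image_comp)

lemma gen_perm_image [simp]: "gen_perm x ` gen_interval x = gen_interval x"
  by (rule reversal_image_outside) simp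

text \<open>Undoing the moves from the final arrangement reverses the same sets of items, since each
  reversal preserves its interval.\<close>

lemma letters_rev: "letters (f \<circ> list_perm w) (rev w) = rev (letters f w)"
proof (induction w arbitrary: f)
  case (Cons x w)
  have IH: "letters ((f \<circ> gen_perm x) \<circ> list_perm w) (rev w) = rev (letters (f \<circ> gen_perm x) w)"
    by (rule Cons.IH)
  have "letters (f \<circ> list_perm (x # w)) (rev (x # w))
    = rev (letters (f \<circ> gen_perm x) w)
      @ letters (f \<circ> gen_perm x \<circ> (list_perm w \<circ> list_perm (rev w))) [x]"
    using IH by (simp add: letters_append comp_assoc)
  also have "\<dots> = rev (letters f (x # w))"
    unfolding list_perm_rev by (simp add: image_comp_reversal)
  finally show ?case .
qed simp

lemma letters_image: "letters (g \<circ> f) w = map ((`) g) (letters f w)"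
  by (induction w arbitrary: f) (simp_all add: image_comp comp_assoc)

lemma avail_image: "inj f \<Longrightarrow> avail (f ` A) (map ((`) f) w) = avail A w"
  by (induction w) (auto simp: compatible_image inj_image_eq_iff)

lemma reduced_image: "inj f \<Longrightarrow> reduced (map ((`) f) w) = reduced w"
  by (induction w) (auto simp: avail_image)

lemma letters_subset:
  assumes "set w \<subseteq> cactus_gens n" "f ` {1..n} \<subseteq> {1..n}" "inj f" "A \<in> set (letters f w)"
  shows "A \<subseteq> {1..n} \<and> (\<nexists>a. A \<subseteq> {a})"
  using assms
proof (induction w arbitrary: f)
  case (Cons x w)
  have x: "1 \<le> fst x" "fst x < snd x" "snd x \<le> n"
    using Cons.prems(1) by (auto simp: cactus_gens_def)
  show ?case
  proof (cases "A = f ` gen_interval x")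
    case True
    have "gen_interval x \<subseteq> {1..n}" using x by auto
    then have "A \<subseteq> {1..n}" using True Cons.prems(2) by blast
    moreover have "f (fst x) \<in> A" "f (snd x) \<in> A" using True x by auto
    moreover have "f (fst x) \<noteq> f (snd x)" using x injD[OF Cons.prems(3)] by force
    ultimately show ?thesis by auto
  next
    case False
    have "reversal (fst x) (snd x) ` {1..n} = {1..n}"
      using x by (intro reversal_image_outside) auto
    then have "(f \<circ> gen_perm x) ` {1..n} \<subseteq> {1..n}"
      using Cons.prems(2) by (simp add: image_comp_reversal)
    with Cons False show ?thesis by auto
  qed
qed simp


section \<open>Cactus words and their letters determine each other\<close>

abbreviation cactus_eq :: "nat \<Rightarrow> (nat \<times> nat) word \<Rightarrow> (nat \<times> nat) word \<Rightarrow> bool" where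
  "cactus_eq n \<equiv> word_eq (cactus_gens n) (cactus_rels n)"

text \<open>Quantifying over \<open>f\<close> and \<open>y\<close> makes this a congruence: a prefix
  changes the arrangement, a suffix changes the word acted on, and equal permutations give the
  suffix the same letters on both sides.\<close>

definition same_action :: "(nat \<times> nat) list \<Rightarrow> (nat \<times> nat) list \<Rightarrow> bool" where
  "same_action u v \<longleftrightarrow> list_perm u = list_perm v \<and>
    (\<forall>f y. inj f \<longrightarrow> reduced y \<longrightarrow>
      trace_eq (foldr act (letters f u) y) (foldr act (letters f v) y))"

lemma same_action_trace:
  "same_action u v \<Longrightarrow> inj f \<Longrightarrow> reduced y \<Longrightarrow>
    trace_eq (foldr act (letters f u) y) (foldr act (letters f v) y)"
  by (simp add: same_action_def)

lemma same_action_append: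
  assumes "same_action l r"
  shows "same_action (u @ l @ v) (u @ r @ v)"
  using assms unfolding same_action_def
  by (simp add: list_perm_append letters_append foldr_act_cong reduced_foldr_act)

lemma same_action_cancel: "same_action [x, x] []"
  by (simp add: same_action_def act_act image_comp_reversal)

lemma same_action_commute:
  assumes "{p..q} \<inter> {m..r} = {}" "p < q" "m < r"
  shows "same_action [(p, q), (m, r)] [(m, r), (p, q)]"
proof -
  have *: "reversal p q ` {m..r} = {m..r}" "reversal m r ` {p..q} = {p..q}"
    using assms by (auto intro!: reversal_image_outside)
  have "reversal p q (reversal m r i) = reversal m r (reversal p q i)" for i
    using assms by (auto simp: reversal_def)
  moreover have "compatible (f ` {p..q}) (f ` {m..r})" if "inj f" for f :: "nat \<Rightarrow> nat"
    unfolding compatible_image[OF that] using assms by (auto simp: compatible_def)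
  ultimately show ?thesis
    unfolding same_action_def
    by (auto simp: fun_eq_iff image_comp_reversal * intro!: act_commute)
qed

lemma same_action_nested:
  assumes "p \<le> m" "m < r" "r \<le> q"
  shows "same_action [(p, q), (m, r)] [(p + q - r, p + q - m), (p, q)]"
proof -
  let ?m = "p + q - r" and ?r = "p + q - m"
  have *: "reversal p q ` {m..r} = {?m..?r}"
    using assms by (intro reversal_image_inside) auto
  have **: "reversal ?m ?r ` {p..q} = {p..q}"
    using assms by (intro reversal_image_outside) auto
  have "reversal p q (reversal m r i) = reversal ?m ?r (reversal p q i)" for i
    using assms by (auto simp: reversal_def)
  moreover have "f ` {p..q} = f ` {?m..?r} \<or> compatible (f ` {p..q}) (f ` {?m..?r})"
    if "inj f" for f :: "nat \<Rightarrow> nat"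
    unfolding compatible_image[OF that] inj_image_eq_iff[OF that]
    using assms by (auto simp: compatible_def)
  ultimately show ?thesis
    unfolding same_action_def
    by (fastforce simp: fun_eq_iff image_comp_reversal * ** intro!: act_commute)
qed

text \<open>Each defining relation becomes a cancellation or a commutation of letters. Dropping the
  signs by \<open>map fst\<close> is harmless, because the generators are involutions.\<close>

lemma cactus_eq_same_action:
  assumes "cactus_eq n u v"
  shows "same_action (map fst u) (map fst v)"
  using assms
proof induction
  case (refl w)
  show ?case by (simp add: same_action_def)
next
  case (sym u v)
  then show ?case by (simp add: same_action_def trace_sym)
next
  case (trans u v w)
  then have uv: "same_action (map fst u) (map fst v)" and vw: "same_action (map fst v) (map fst w)"
    by simp_all
  then have "list_perm (map fst u) = list_perm (map fst w)" by (simp add: same_action_def)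
  then show ?case
    unfolding same_action_def using trace_trans[OF same_action_trace[OF uv] same_action_trace[OF vw]]
    by blast
next
  case (cancel x u v b)
  show ?case using same_action_append[OF same_action_cancel, of "map fst u" x "map fst v"] by simp
next
  case (rel l r u v)
  have "same_action (map fst l) (map fst r)"
    using rel.hyps(1) same_action_cancel
    by (auto simp: cactus_rels_def cactus_gens_def intro!: same_action_commute same_action_nested)
  then show ?case by (simp add: same_action_append)
qed

section \<open>From letters back to words\<close>

abbreviation gen_word :: "(nat \<times> nat) list \<Rightarrow> (nat \<times> nat) word" where
  "gen_word w \<equiv> map (\<lambda>x. (x, True)) w"

lemma gen_word_words [simp]: "gen_word w \<in> words X \<longleftrightarrow> set w \<subseteq> X"
  by (induction w) auto

lemma cactus_eq_rel: "(l, r) \<in> cactus_rels n \<Longrightarrow> cactus_eq n l r"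
  using word_eq.rel[of l r "cactus_rels n" "[]" "[]"] cactus_rels_words by auto

lemma cactus_eq_square:
  "x \<in> cactus_gens n \<Longrightarrow> cactus_eq n (gen_word [x, x]) []"
  by (rule cactus_eq_rel, cases x) (auto simp: cactus_rels_def)

lemma cactus_eq_commute:
  assumes "x \<in> cactus_gens n" "y \<in> cactus_gens n" "gen_interval x \<inter> gen_interval y = {}"
  shows "cactus_eq n (gen_word [x, y]) (gen_word [y, x])"
  using assms by (intro cactus_eq_rel, cases x, cases y) (auto simp: cactus_rels_def)

lemma cactus_eq_nested:
  assumes "(p, q) \<in> cactus_gens n" "p \<le> m" "m < r" "r \<le> q"
  shows "cactus_eq n (gen_word [(p, q), (m, r)]) (gen_word [(p + q - r, p + q - m), (p, q)])"
proof -
  have "(m, r) \<in> cactus_gens n" using assms by (auto simp: cactus_gens_def)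
  then show ?thesis using assms by (intro cactus_eq_rel) (auto simp: cactus_rels_def)
qed

lemma cactus_eq_gen_word:
  assumes "w \<in> words (cactus_gens n)"
  shows "cactus_eq n w (gen_word (map fst w))"
  using assms
proof (induction w)
  case Nil
  show ?case by (simp add: word_eq.refl)
next
  case (Cons a w)
  obtain x b where a: "a = (x, b)" by (cases a)
  have x: "x \<in> cactus_gens n" using Cons.prems a by simp
  have "cactus_eq n [(x, b)] [(x, True)]"
  proof (cases b)
    case False
    have "cactus_eq n ([(x, False)] @ []) ([(x, False)] @ gen_word [x, x])"
      using x by (intro word_eq_append_left word_eq.sym[OF cactus_eq_square]) auto
    moreover have "cactus_eq n ([] @ [(x, False), (x, \<not> False)] @ [(x, True)]) ([] @ [(x, True)])"
      using x by (intro word_eq.cancel) auto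
    ultimately show ?thesis using False by (auto intro: word_eq.trans)
  qed (use x in \<open>simp add: word_eq.refl\<close>)
  from word_eq_append[OF this Cons.IH] show ?case using Cons.prems a by simp
qed

text \<open>Every commutation of letters lifts to one of the relations (j2), (j3).\<close>

lemma avail_letters_front:
  assumes "set w \<subseteq> cactus_gens n" "x \<in> cactus_gens n" "inj f"
    and "avail (f ` gen_interval x) (letters f w)"
  shows "\<exists>v. set v \<subseteq> cactus_gens n \<and> length w = Suc (length v) \<and>
    cactus_eq n (gen_word w) (gen_word (x # v))"
  using assms
proof (induction w arbitrary: f x)
  case (Cons y w)
  obtain p q m r where xy: "x = (p, q)" "y = (m, r)" by (cases x; cases y)
  have pq: "1 \<le> p" "p < q" "q \<le> n" and mr: "1 \<le> m" "m < r" "r \<le> n"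
    using Cons.prems(1,2) xy by (auto simp: cactus_gens_def)
  have w: "set w \<subseteq> cactus_gens n" and y: "y \<in> cactus_gens n" using Cons.prems by auto
  show ?case
  proof (cases "x = y")
    case True
    then show ?thesis using Cons.prems(1) by (intro exI[of _ w]) (auto intro: word_eq.refl)
  next
    case False
    have "{m..r} \<noteq> {p..q}" using False xy pq mr by auto
    then have compatible: "compatible {p..q} {m..r}"
      and avail: "avail (f ` {p..q}) (letters (f \<circ> gen_perm y) w)"
      using Cons.prems(3,4) xy by (auto simp: inj_image_eq_iff compatible_image)
    \<comment> \<open>Here \<open>x'\<close> occupies the positions that hold the items of
      \<open>x\<close> once \<open>y\<close> has been applied. By induction it moves to the front of
      \<open>w\<close>, and one relation turns \<open>y\<close>, \<open>x'\<close> into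
      \<open>x\<close>, \<open>y'\<close>.\<close>
    have *: ?thesis
      if x': "x' \<in> cactus_gens n" "gen_perm y ` gen_interval x' = {p..q}"
        and y': "y' \<in> cactus_gens n" "cactus_eq n (gen_word [y, x']) (gen_word [x, y'])" for x' y'
    proof -
      have "(f \<circ> gen_perm y) ` gen_interval x' = f ` {p..q}"
        using x'(2) by (simp only: image_comp_reversal)
      then have "avail ((f \<circ> gen_perm y) ` gen_interval x') (letters (f \<circ> gen_perm y) w)"
        using avail by metis
      from Cons.IH[OF w x'(1) inj_comp[OF Cons.prems(3) inj_reversal] this] obtain v where v: "set v \<subseteq> cactus_gens n"
        "length w = Suc (length v)" "cactus_eq n (gen_word w) (gen_word (x' # v))"
        by blast
      have "cactus_eq n (gen_word (y # w)) (gen_word (y # x' # v))"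
        using word_eq_append_left[OF v(3), of "gen_word [y]"] y by simp
      also have "cactus_eq n (gen_word (y # x' # v)) (gen_word (x # y' # v))"
        using word_eq_append_right[OF y'(2), of "gen_word v"] v by simp
      finally (word_eq.trans) show ?thesis using v y' by (intro exI[of _ "y' # v"]) auto
    qed
    from compatible consider "{p..q} \<inter> {m..r} = {}" | "{p..q} \<subseteq> {m..r}" | "{m..r} \<subseteq> {p..q}"
      by (auto simp: compatible_def)
    then show ?thesis
    proof cases
      case 1
      then show ?thesis using Cons.prems y xy
        by (intro *[of x y] cactus_eq_commute) (auto intro!: reversal_image_outside)
    next
      case 2
      then have le: "m \<le> p" "q \<le> r" using pq by auto
      let ?x = "(m + r - q, m + r - p)"
      have "?x \<in> cactus_gens n" using le pq mr by (auto simp: cactus_gens_def)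
      moreover have "reversal m r ` {m + r - q..m + r - p} = {p..q}"
        using le pq mr by (subst reversal_image_inside) auto
      moreover have "cactus_eq n (gen_word [y, ?x]) (gen_word [x, y])"
        using cactus_eq_nested[of m r n "m + r - q" "m + r - p"] le pq mr y xy by simp
      ultimately show ?thesis using y xy by (intro *[of ?x y]) auto
    next
      case 3
      then have le: "p \<le> m" "r \<le> q" using mr by auto
      let ?y = "(p + q - r, p + q - m)"
      have "?y \<in> cactus_gens n" using le pq mr by (auto simp: cactus_gens_def)
      moreover have "reversal m r ` {p..q} = {p..q}"
        using 3 by (intro reversal_image_outside) auto
      moreover have "cactus_eq n (gen_word [x, ?y]) (gen_word [y, x])"
        using cactus_eq_nested[of p q n "p + q - r" "p + q - m"] le pq mr Cons.prems(2) xy by simp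
      ultimately show ?thesis using Cons.prems(2) xy by (intro *[of x ?y]) (auto intro: word_eq.sym)
    qed
  qed
qed simp

lemma shorten_nonreduced:
  assumes "set w \<subseteq> cactus_gens n" "inj f" "\<not> reduced (letters f w)"
  shows "\<exists>v. set v \<subseteq> cactus_gens n \<and> length v < length w \<and> cactus_eq n (gen_word w) (gen_word v)"
  using assms
proof (induction w arbitrary: f)
  case (Cons x w)
  let ?f = "f \<circ> gen_perm x"
  have x: "x \<in> cactus_gens n" and w: "set w \<subseteq> cactus_gens n" and f: "inj ?f"
    using Cons.prems by auto
  show ?case
  proof (cases "reduced (letters ?f w)")
    case True
    \<comment> \<open>Right after \<open>x\<close> its interval still holds the same items. So an
      entry of \<open>w\<close> with the letter of \<open>x\<close> can be brought to the front of
      \<open>w\<close>, where it is \<open>x\<close> itself and cancels.\<close>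
    have "?f ` gen_interval x = f ` gen_interval x" by (simp only: image_comp_reversal gen_perm_image)
    with True Cons.prems have "avail (?f ` gen_interval x) (letters ?f w)" by simp
    from avail_letters_front[OF w x f this] obtain v where v: "set v \<subseteq> cactus_gens n"
      "length w = Suc (length v)" "cactus_eq n (gen_word w) (gen_word (x # v))" by blast
    have "cactus_eq n (gen_word (x # w)) (gen_word (x # x # v))"
      using word_eq_append_left[OF v(3), of "gen_word [x]"] x by simp
    also have "cactus_eq n (gen_word (x # x # v)) (gen_word v)"
      using word_eq_append_right[OF cactus_eq_square[OF x], of "gen_word v"] v by simp
    finally (word_eq.trans) show ?thesis using v by auto
  next
    case False
    from Cons.IH[OF w f this] obtain v where v: "set v \<subseteq> cactus_gens n"
      "length v < length w" "cactus_eq n (gen_word w) (gen_word v)" by blast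
    then have "cactus_eq n (gen_word (x # w)) (gen_word (x # v))"
      using word_eq_append_left[OF v(3), of "gen_word [x]"] x by simp
    with v x show ?thesis by (intro exI[of _ "x # v"]) auto
  qed
qed simp

lemma exists_reduced:
  assumes "w \<in> words (cactus_gens n)"
  obtains v where "set v \<subseteq> cactus_gens n" "cactus_eq n w (gen_word v)" "reduced (letters id v)"
proof -
  define P where "P v \<longleftrightarrow> set v \<subseteq> cactus_gens n \<and> cactus_eq n w (gen_word v)" for v
  have "P (map fst w)"
    using cactus_eq_gen_word[OF assms] word_eq_words[OF cactus_eq_gen_word[OF assms]]
    unfolding P_def gen_word_words by blast
  then obtain v where v: "P v" and least: "\<And>u. P u \<Longrightarrow> length v \<le> length u"
    using ex_has_least_nat[of P _ length] by blast
  have "reduced (letters id v)"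
  proof (rule ccontr)
    assume "\<not> reduced (letters id v)"
    with v obtain u where "set u \<subseteq> cactus_gens n" "length u < length v"
      "cactus_eq n (gen_word v) (gen_word u)"
      using shorten_nonreduced[of v n id] by (auto simp: P_def)
    then have "P u" "length u < length v" using v by (auto simp: P_def intro: word_eq.trans)
    with least show False by (simp add: leD)
  qed
  with v that show ?thesis by (auto simp: P_def)
qed

section \<open>Rotations of a block of positions\<close>

text \<open>For \<open>m\<close> at least 3, each pair of reversals shifts the block of
  \<open>m\<close> positions cyclically by two, so the word is pure when \<open>m\<close> divides
  \<open>k\<close>.\<close>

definition rotation_word :: "nat \<Rightarrow> nat \<Rightarrow> nat \<Rightarrow> (nat \<times> nat) list" where
  "rotation_word p m k = concat (replicate k [(p, p + m - 2), (p + 1, p + m - 1)])"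

text \<open>The item missing from letter number \<open>t\<close> of a rotation word, counted from 0;
  it runs cyclically from the last item of the block down to the first.\<close>

definition omitted :: "nat \<Rightarrow> nat \<Rightarrow> nat \<Rightarrow> nat" where
  "omitted p m t = p + m - 1 - t mod m"

lemma omitted_in: "0 < m \<Longrightarrow> omitted p m t \<in> {p..<p + m}"
  using mod_less_divisor[of m t] by (auto simp: omitted_def simp del: mod_less_divisor)

lemma omitted_periodic: "omitted p m (t + m) = omitted p m t"
  by (simp add: omitted_def)

lemma omitted_Suc: "2 \<le> m \<Longrightarrow> omitted p m (Suc t) \<noteq> omitted p m t"
  using mod_less_divisor[of m t] by (auto simp: omitted_def mod_Suc simp del: mod_less_divisor)

lemma omitted_shift:
  assumes "m dvd s" "i \<in> {p..<p + m}"
  shows "omitted p m (s + (p + m - 1 - i)) = i"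
proof -
  obtain c where "s = m * c" using assms(1) by blast
  moreover have "(m * c + (p + m - 1 - i)) mod m = p + m - 1 - i"
    using assms(2) by (subst mod_mult_self4) auto
  ultimately have "omitted p m (s + (p + m - 1 - i)) = p + m - 1 - (p + m - 1 - i)"
    by (simp only: omitted_def)
  then show ?thesis using assms(2) by auto
qed

lemma omitted_surj:
  assumes "m dvd s" "i \<in> {p..<p + m}"
  shows "\<exists>t\<in>{s..<s + m}. omitted p m t = i"
proof
  show "omitted p m (s + (p + m - 1 - i)) = i"
    using assms by (rule omitted_shift)
  show "s + (p + m - 1 - i) \<in> {s..<s + m}" using assms by auto
qed

text \<open>The last hypothesis says that, from right to left, the items stand in the order in which
  they are omitted from step \<open>s\<close> on. One pair of reversals turns this into the same
  statement for \<open>s + 2\<close>, which drives the induction.\<close>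

lemma letters_rotation_word:
  assumes "3 \<le> m" "inj f" "f ` {p..<p + m} = {p..<p + m}"
    and "\<And>i. i \<in> {p..<p + m} \<Longrightarrow> f i = omitted p m (s + (p + m - 1 - i))"
  shows "letters f (rotation_word p m k)
      = map (\<lambda>t. {p..<p + m} - {omitted p m t}) [s..<s + 2 * k] \<and>
    (\<forall>i\<in>{p..<p + m}. f (list_perm (rotation_word p m k) i)
      = omitted p m (s + 2 * k + (p + m - 1 - i)))"
  using assms
proof (induction k arbitrary: f s)
  case 0
  then show ?case by (simp add: rotation_word_def)
next
  case (Suc k)
  let ?B = "{p..<p + m}"
  let ?r1 = "reversal p (p + m - 2)" and ?r2 = "reversal (p + 1) (p + m - 1)"
  let ?g = "f \<circ> ?r1 \<circ> ?r2"
  note m = Suc.prems(1) and f = Suc.prems(2-4)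
  have rB: "?r1 ` ?B = ?B" "?r2 ` ?B = ?B"
    using m by (auto intro!: reversal_image_outside)
  have "{p..p + m - 2} = ?B - {p + m - 1}" using m by auto
  then have "f ` {p..p + m - 2} = ?B - {f (p + m - 1)}"
    using f(1,2) by (simp add: image_set_diff)
  then have l1: "f ` {p..p + m - 2} = ?B - {omitted p m s}"
    using f(3)[of "p + m - 1"] m by simp
  have "{p + 1..p + m - 1} = ?B - {p}" using m by auto
  then have "(f \<circ> ?r1) ` {p + 1..p + m - 1} = ?B - {f (?r1 p)}"
    using f(1,2) rB(1) by (simp add: image_set_diff image_comp_reversal)
  moreover have "?r1 p = p + m - 2" using m by (auto simp: reversal_def)
  ultimately have l2: "(f \<circ> ?r1) ` {p + 1..p + m - 1} = ?B - {omitted p m (Suc s)}"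
    using f(3)[of "p + m - 2"] m by simp
  have g: "?g i = omitted p m (s + 2 + (p + m - 1 - i))" if i: "i \<in> ?B" for i
  proof -
    consider "i = p" | "i = p + 1" | "p + 2 \<le> i" using i by force
    then show ?thesis
    proof cases
      case 1
      then have "?r1 (?r2 i) = p + m - 2" using m by (auto simp: reversal_def)
      moreover have "s + 2 + (p + m - 1 - i) = s + 1 + m" using 1 m by simp
      ultimately have "?g i = omitted p m (s + 1)" using f(3)[of "p + m - 2"] m by simp
      then show ?thesis unfolding \<open>s + 2 + (p + m - 1 - i) = s + 1 + m\<close> omitted_periodic .
    next
      case 2
      then have "?r1 (?r2 i) = p + m - 1" using m by (auto simp: reversal_def)
      moreover have "s + 2 + (p + m - 1 - i) = s + m" using 2 m by simp
      ultimately have "?g i = omitted p m s" using f(3)[of "p + m - 1"] m by simp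
      then show ?thesis unfolding \<open>s + 2 + (p + m - 1 - i) = s + m\<close> omitted_periodic .
    next
      case 3
      then have "?r1 (?r2 i) = i - 2" using m i by (auto simp: reversal_def)
      moreover have "f (i - 2) = omitted p m (s + (p + m - 1 - (i - 2)))"
        using 3 i by (intro f(3)) auto
      moreover have "s + 2 + (p + m - 1 - i) = s + (p + m - 1 - (i - 2))" using 3 i by auto
      ultimately show ?thesis by (simp only: comp_apply)
    qed
  qed
  have gB: "?g ` ?B = ?B" using f(2) rB by (simp add: image_comp_reversal)
  have ginj: "inj ?g" using f(1) by (intro inj_comp inj_reversal)
  have IH: "letters ?g (rotation_word p m k)
      = map (\<lambda>t. ?B - {omitted p m t}) [s + 2..<s + 2 + 2 * k] \<and>
    (\<forall>i\<in>?B. ?g (list_perm (rotation_word p m k) i) = omitted p m (s + 2 + 2 * k + (p + m - 1 - i)))"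
    by (rule Suc.IH[OF m ginj gB g])
  have w: "rotation_word p m (Suc k) = (p, p + m - 2) # (p + 1, p + m - 1) # rotation_word p m k"
    by (simp add: rotation_word_def)
  have "[s..<s + 2 * Suc k] = s # Suc s # [s + 2..<s + 2 + 2 * k]"
    by (simp add: upt_conv_Cons)
  then show ?case using l1 l2 IH unfolding w by (simp add: comp_assoc)
qed

lemma list_perm_outside:
  "(\<And>x. x \<in> set w \<Longrightarrow> i \<notin> gen_interval x) \<Longrightarrow> list_perm w i = i"
  by (induction w) (auto simp: reversal_def)

lemma set_rotation_word: "set (rotation_word p m k) \<subseteq> {(p, p + m - 2), (p + 1, p + m - 1)}"
  by (auto simp: rotation_word_def)

lemma letters_id_rotation_word:
  assumes "3 \<le> m"
  shows "letters id (rotation_word p m k)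
      = map (\<lambda>t. {p..<p + m} - {omitted p m t}) [0..<2 * k]"
    and "m dvd k \<Longrightarrow> list_perm (rotation_word p m k) = id"
proof -
  have id: "id i = omitted p m (0 + (p + m - 1 - i))" if "i \<in> {p..<p + m}" for i
    using omitted_shift[of m 0 i p] that by simp
  have *: "letters id (rotation_word p m k)
      = map (\<lambda>t. {p..<p + m} - {omitted p m t}) [0..<0 + 2 * k] \<and>
    (\<forall>i\<in>{p..<p + m}. id (list_perm (rotation_word p m k) i)
      = omitted p m (0 + 2 * k + (p + m - 1 - i)))"
    using assms id by (intro letters_rotation_word) auto
  then show "letters id (rotation_word p m k)
      = map (\<lambda>t. {p..<p + m} - {omitted p m t}) [0..<2 * k]"
    by simp
  show "list_perm (rotation_word p m k) = id" if "m dvd k"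
  proof
    fix i
    show "list_perm (rotation_word p m k) i = id i"
    proof (cases "i \<in> {p..<p + m}")
      case True
      then have "list_perm (rotation_word p m k) i = omitted p m (2 * k + (p + m - 1 - i))"
        using * by simp
      also have "\<dots> = i" using that True by (intro omitted_shift) auto
      finally show ?thesis by simp
    next
      case False
      then show ?thesis using assms set_rotation_word[of p m k]
        by (auto intro!: list_perm_outside)
    qed
  qed
qed

text \<open>A third item lies in both sets, and neither set contains the other.\<close>

lemma not_compatible_omit:
  fixes p m a b :: nat
  assumes "3 \<le> m" "a \<in> {p..<p + m}" "b \<in> {p..<p + m}" "a \<noteq> b"
  shows "\<not> compatible ({p..<p + m} - {a}) ({p..<p + m} - {b})"
proof -
  have "card ({p..<p + m} - {a, b}) > 0" using assms by (simp add: card_Diff_subset)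
  then obtain c where "c \<in> {p..<p + m} - {a, b}" by (metis card_gt_0_iff ex_in_conv)
  then show ?thesis using assms unfolding compatible_def by blast
qed

lemma chain_letters_rotation_word:
  assumes "3 \<le> m"
  shows "chain (letters id (rotation_word p m k))"
proof -
  have "\<not> compatible ({p..<p + m} - {omitted p m t}) ({p..<p + m} - {omitted p m (Suc t)})" for t
    using assms omitted_in[of m p] omitted_Suc[of m p t] by (intro not_compatible_omit) auto
  moreover have "{p..<p + m} - {omitted p m t} \<noteq> {p..<p + m} - {omitted p m (Suc t)}" for t
  proof -
    have "omitted p m (Suc t) \<in> {p..<p + m} - {omitted p m t}"
      using assms omitted_in[of m p "Suc t"] omitted_Suc[of m p t] by simp
    then show ?thesis by blast
  qed
  ultimately show ?thesis
    unfolding letters_id_rotation_word(1)[OF assms] successively_conv_nth by simp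
qed

section \<open>Centers\<close>

text \<open>Asking for commutation with pure words only lets this serve both centers, as central
  elements of the whole group turn out to be pure. Purity makes the letters of a product the
  concatenation of the letters of its factors.\<close>

definition pure_central :: "nat \<Rightarrow> (nat \<times> nat) list \<Rightarrow> bool" where
  "pure_central n w \<longleftrightarrow> set w \<subseteq> cactus_gens n \<and> reduced (letters id w) \<and> list_perm w = id \<and>
    (\<forall>u. set u \<subseteq> cactus_gens n \<longrightarrow> list_perm u = id \<longrightarrow>
      cactus_eq n (gen_word (w @ u)) (gen_word (u @ w)))"

lemma cactus_eq_rev:
  assumes "set w \<subseteq> cactus_gens n"
  shows "cactus_eq n (gen_word (rev w @ w)) []"
  using assms
proof (induction w)
  case Nil
  show ?case by (simp add: word_eq.refl)
next
  case (Cons x w)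
  have "cactus_eq n (gen_word (rev w) @ gen_word [x, x]) (gen_word (rev w) @ [])"
    using Cons.prems by (intro word_eq_append_left cactus_eq_square) auto
  from word_eq_append_right[OF this, of "gen_word w"]
  have "cactus_eq n (gen_word (rev (x # w) @ x # w)) (gen_word (rev w @ w))"
    using Cons.prems by simp
  with Cons show ?case by (auto intro: word_eq.trans)
qed

lemma letters_id_rev: "list_perm w = id \<Longrightarrow> letters id (rev w) = rev (letters id w)"
  using letters_rev[of id w] by simp

lemma list_perm_id_rev: "list_perm w = id \<Longrightarrow> list_perm (rev w) = id"
  using list_perm_rev[of w] by simp

text \<open>As the generators are involutions, \<open>rev w\<close> is the inverse of
  \<open>w\<close>. It turns statements about how \<open>w\<close> can start into statements about
  how it can end.\<close>

lemma pure_central_rev: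
  assumes "pure_central n w"
  shows "pure_central n (rev w)"
proof -
  have w: "set w \<subseteq> cactus_gens n" using assms by (simp add: pure_central_def)
  have "cactus_eq n (gen_word (rev w @ u)) (gen_word (u @ rev w))"
    if u: "set u \<subseteq> cactus_gens n" "list_perm u = id" for u
  proof -
    have swap: "cactus_eq n (gen_word (u @ w)) (gen_word (w @ u))"
      using assms u by (auto simp: pure_central_def intro: word_eq.sym)
    have "cactus_eq n [] (gen_word (w @ rev w))"
      using word_eq.sym[OF cactus_eq_rev[of "rev w" n]] w by simp
    from word_eq_append_left[OF this, of "gen_word (rev w @ u)"]
    have "cactus_eq n (gen_word (rev w @ u)) (gen_word (rev w @ u @ w @ rev w))"
      using w u by simp
    also have "cactus_eq n (gen_word (rev w @ u @ w @ rev w)) (gen_word (rev w @ w @ u @ rev w))"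
      using word_eq_append_right[OF word_eq_append_left[OF swap, of "gen_word (rev w)"],
          of "gen_word (rev w)"] w by simp
    also (word_eq.trans) have "cactus_eq n (gen_word (rev w @ w @ u @ rev w)) (gen_word (u @ rev w))"
      using word_eq_append_right[OF cactus_eq_rev[OF w], of "gen_word (u @ rev w)"] w u by simp
    finally (word_eq.trans) show ?thesis .
  qed
  then show ?thesis using assms
    by (auto simp: pure_central_def letters_id_rev list_perm_id_rev reduced_rev)
qed

lemma pure_central_chain:
  assumes w: "pure_central n w" and u: "set u \<subseteq> cactus_gens n" "list_perm u = id"
    and e: "letters id u = e1 @ e2" "chain (letters id u)" "e1 \<noteq> []" "length w < length e2"
    and "\<not> avail (hd e1) (rev (letters id w))" "avail A (letters id w)"
  shows "A = hd e1 \<or> (\<forall>B\<in>set e1. compatible A B)"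
proof -
  have "same_action (w @ u) (u @ w)"
    using cactus_eq_same_action[of n "gen_word (w @ u)" "gen_word (u @ w)"] w u
    by (simp add: pure_central_def comp_def)
  then have "trace_eq (foldr act (letters id (w @ u)) []) (foldr act (letters id (u @ w)) [])"
    by (rule same_action_trace) simp_all
  then show ?thesis
    using assms by (intro avail_commuting_chain[of "letters id w" e1 e2])
      (auto simp: pure_central_def letters_append)
qed

lemma pure_central_letters:
  assumes "pure_central n w" "A \<in> set (letters id w)"
  shows "A \<subseteq> {1..n} \<and> (\<nexists>a. A \<subseteq> {a})"
  using letters_subset[of w n id A] assms by (simp add: pure_central_def)

lemma rotation_word_gens:
  assumes "3 \<le> m" "1 \<le> p" "p + m \<le> Suc n"
  shows "set (rotation_word p m k) \<subseteq> cactus_gens n"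
  using set_rotation_word[of p m k] assms by (auto simp: cactus_gens_def)

section \<open>Letters with which a central word can start\<close>

lemma compatible_with_all_omissions:
  assumes "A \<subseteq> N" "\<nexists>a. A \<subseteq> {a}" "\<And>b. b \<in> N \<Longrightarrow> compatible A (N - {b})"
  shows "A = N"
proof -
  obtain a where a: "a \<in> A" using assms(2) by auto
  then have "compatible A (N - {a})" using assms by auto
  \<comment> \<open>\<open>A\<close> has a second element, so it meets \<open>N - {a}\<close>, and
    it is not contained in that set because of \<open>a\<close>.\<close>
  then have "N - {a} \<subseteq> A" using assms(1,2) a unfolding compatible_def by blast
  then show ?thesis using assms(1) a by blast
qed

lemma pure_central_avail_large:
  assumes n: "3 \<le> n" and w: "pure_central n w" and A: "avail A (letters id w)"
  shows "A \<in> {{1..n} - {n}, {1..n} - {1}, {1..n}}"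
proof -
  let ?N = "{1..<1 + n}" and ?a = "omitted 1 n"
  \<comment> \<open>A multiple of \<open>n\<close> makes \<open>u\<close> pure; the other factor
    leaves more than \<open>length w\<close> letters beyond \<open>n\<close> of them.\<close>
  define k where "k = n * Suc (length w)"
  define u where "u = rotation_word 1 n k"
  let ?L = "\<lambda>t. ?N - {?a t}"
  have N: "?N = {1..n}" by auto
  have u: "set u \<subseteq> cactus_gens n" "list_perm u = id" "letters id u = map ?L [0..<2 * k]"
    "chain (letters id u)"
    using n letters_id_rotation_word(1)[of n 1 k] letters_id_rotation_word(2)[of n k 1]
      rotation_word_gens[of n 1 n k]
      chain_letters_rotation_word[of n 1 k] by (simp_all add: u_def k_def)
  have k: "n dvd 2 * k" "n + length w < 2 * k"
  proof -
    have "1 * Suc (length w) \<le> k" "n * 1 \<le> k" using n unfolding k_def by (intro mult_le_mono; simp)+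
    then show "n + length w < 2 * k" by simp
  qed (simp add: k_def)
  \<comment> \<open>Any \<open>n\<close> consecutive letters, here those from \<open>s\<close> on,
    together omit every item.\<close>
  have all: "A = {1..n}" if "\<And>t. t \<in> {s..<s + n} \<Longrightarrow> compatible A (?L t)" "n dvd s" for s
  proof (rule compatible_with_all_omissions)
    show "compatible A ({1..n} - {b})" if "b \<in> {1..n}" for b
      using omitted_surj[of n s b 1] \<open>n dvd s\<close> that \<open>\<And>t. t \<in> {s..<s + n} \<Longrightarrow> _ t\<close> N by fastforce
  qed (use pure_central_letters[OF w avail_in_set[OF A]] in auto)
  show ?thesis
  proof (cases "avail ({1..n} - {n}) (rev (letters id w))")
    case False
    let ?e1 = "map ?L [0..<n]" and ?e2 = "map ?L [n..<2 * k]"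
    have "[0..<2 * k] = [0..<n] @ [n..<2 * k]"
      using k(2) upt_add_eq_append[of 0 n "2 * k - n"] by simp
    then have e: "letters id u = ?e1 @ ?e2" using u(3) by (simp only: map_append)
    have hd: "hd ?e1 = {1..n} - {n}" using n by (auto simp: hd_map omitted_def)
    have "A = hd ?e1 \<or> (\<forall>B\<in>set ?e1. compatible A B)"
      by (rule pure_central_chain[OF w u(1,2) e u(4)]) (use n k(2) hd False A in auto)
    then show ?thesis using hd all[of 0] by auto
  next
    \<comment> \<open>If \<open>w\<close> can end with the first letter of \<open>u\<close>, the
      chain is run backwards: \<open>rev u\<close> starts with \<open>{1..n} - {1}\<close>, and
      \<open>w\<close> cannot end with both letters because they do not commute.\<close>
    case True
    have "\<not> avail ({1..n} - {1}) (rev (letters id w))"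
    proof
      assume "avail ({1..n} - {1}) (rev (letters id w))"
      moreover have "1 \<in> {1..n} - {n}" using n by simp
      then have "{1..n} - {n} \<noteq> {1..n} - {1}" by blast
      ultimately have "compatible ({1..n} - {n}) ({1..n} - {1})"
        using avail_comm[OF True] by blast
      then show False using not_compatible_omit[of n n 1 1] n N by auto
    qed
    moreover define s where "s = 2 * k - n"
    let ?e1 = "rev (map ?L [s..<s + n])" and ?e2 = "rev (map ?L [0..<s])"
    have s: "n dvd s" "2 * k = s + n" "length w < s" using k by (auto simp: s_def)
    have "[0..<2 * k] = [0..<s] @ [s..<s + n]"
      using upt_add_eq_append[of 0 s n] s by simp
    then have e: "letters id (rev u) = ?e1 @ ?e2"
      using u(2,3) by (simp only: letters_id_rev map_append rev_append)
    have "(s + n - 1) mod n = n - 1"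
    proof -
      obtain c where "s = n * c" using s(1) by blast
      then have "(s + n - 1) mod n = (n * c + (n - 1)) mod n" using n by simp
      also have "\<dots> = n - 1" using n by (subst mod_mult_self4) auto
      finally show ?thesis .
    qed
    then have hd: "hd ?e1 = {1..n} - {1}"
      using n by (auto simp: hd_rev last_map omitted_def)
    have "chain (letters id (rev u))"
      using u(4) comm_sym unfolding letters_id_rev[OF u(2)] successively_rev
      by (auto elim!: successively_mono)
    then have "A = hd ?e1 \<or> (\<forall>B\<in>set ?e1. compatible A B)"
      using u(1) hd s(3) n A calculation
      by (intro pure_central_chain[OF w _ list_perm_id_rev[OF u(2)] e]) auto
    then show ?thesis using hd all[OF _ s(1)] by auto
  qed
qed

lemma pure_central_avail:
  assumes n: "4 \<le> n" and w: "pure_central n w" and A: "avail A (letters id w)"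
  shows "A = {1..n}"
proof -
  have n3: "3 \<le> n" using n by simp
  \<comment> \<open>The same argument in a block of three positions, whose rotation starts with
    \<open>{p, p + 1}\<close>. That \<open>w\<close> cannot end with this letter follows from the
    previous lemma for \<open>rev w\<close>, since for \<open>n > 3\<close> the three letters
    allowed there have more than two items.\<close>
  have *: "A = {p, p + 1}"
    if p: "1 \<le> p" "p + 2 \<le> n"
      and t: "t < 3" "\<not> compatible A ({p..<p + 3} - {omitted p 3 t})" for p t
  proof -
    let ?L = "\<lambda>t. {p..<p + 3} - {omitted p 3 t}"
    define k where "k = 3 * (length w + 2)"
    let ?u = "rotation_word p 3 k" and ?e1 = "map ?L [0..<3]" and ?e2 = "map ?L [3..<2 * k]"
    have "[0..<2 * k] = [0..<3] @ [3..<2 * k]"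
      using upt_add_eq_append[of 0 3 "2 * k - 3"] by (simp add: k_def)
    then have e: "letters id ?u = ?e1 @ ?e2"
      by (simp only: letters_id_rotation_word map_append order_refl)
    have hd: "hd ?e1 = {p, p + 1}"
      by (auto simp: hd_map omitted_def)
    have "{p, p + 1} \<notin> {{1..n} - {n}, {1..n} - {1}, {1..n}}"
    proof
      assume "{p, p + 1} \<in> {{1..n} - {n}, {1..n} - {1}, {1..n}}"
      then have "card {p, p + 1} \<in> card ` {{1..n} - {n}, {1..n} - {1}, {1..n}}" by (rule imageI)
      then show False using n by (simp add: card_Diff_subset)
    qed
    then have "\<not> avail (hd ?e1) (rev (letters id w))"
      using pure_central_avail_large[OF n3 pure_central_rev[OF w], of "{p, p + 1}"] w
      unfolding hd pure_central_def by (metis letters_id_rev)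
    then have "A = hd ?e1 \<or> (\<forall>B\<in>set ?e1. compatible A B)"
      using p rotation_word_gens[of 3 p n k] chain_letters_rotation_word[of 3 p k] A
      by (intro pure_central_chain[OF w _ letters_id_rotation_word(2) e]) (simp_all add: k_def)
    with hd t show ?thesis by auto
  qed
  have False if "A = {1..n} - {1}"
  proof -
    have "{1..<1 + 3} - {omitted 1 3 0} = {1, 2}" by (auto simp: omitted_def)
    moreover have "2 \<in> A" "1 \<notin> A" "3 \<in> A" using that n by auto
    ultimately have "\<not> compatible A ({1..<1 + 3} - {omitted 1 3 0})" and A1: "A \<noteq> {1, 1 + 1}"
      by (auto simp: compatible_def)
    then have "A = {1, 1 + 1}" using n by (intro *[of 1 0]) auto
    with A1 show False by blast
  qed
  moreover have False if "A = {1..n} - {n}"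
  proof -
    define p where "p = n - 2"
    then have p: "n = p + 2" "2 \<le> p" using n by auto
    \<comment> \<open>Letter 0 is \<open>{p, p + 1}\<close>, which lies inside \<open>A\<close> and
      so gives nothing. Letter 1 contains the item \<open>n = p + 2\<close> missing from
      \<open>A\<close>.\<close>
    have B: "{p..<p + 3} - {omitted p 3 1} = {p, p + 2}" by (auto simp: omitted_def)
    have "p \<in> A" "p + 2 \<notin> A" "1 \<in> A" "1 \<notin> {p, p + 2}" "1 \<notin> {p, p + 1}" using that p by auto
    then have "\<not> compatible A ({p..<p + 3} - {omitted p 3 1})" and A1: "A \<noteq> {p, p + 1}"
      unfolding B compatible_def by blast+
    then have "A = {p, p + 1}" using p by (intro *[of p 1]) auto
    with A1 show False by blast
  qed
  ultimately show ?thesis using pure_central_avail_large[OF n3 w A] by blast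
qed

text \<open>\<open>{1..n}\<close> commutes with every other letter, so a second letter could move to
  the front too and would have to equal \<open>{1..n}\<close>, against reducedness. A single
  \<open>(1, n)\<close> is not pure.\<close>

lemma pure_central_Nil:
  assumes n: "2 \<le> n" and w: "pure_central n w"
    and avail: "\<And>A. avail A (letters id w) \<Longrightarrow> A = {1..n}"
  shows "w = []"
proof (cases w)
  case (Cons x v)
  have x: "gen_interval x = {1..n}" by (intro avail) (simp add: Cons)
  moreover have "fst x < snd x" using w Cons by (auto simp: pure_central_def cactus_gens_def)
  ultimately have x': "x = (1, n)" by (cases x) auto
  show ?thesis
  proof (cases v)
    case Nil
    then have "reversal 1 n = id" using w Cons x' by (simp add: pure_central_def)
    then have "reversal 1 n 1 = 1" by simp
    then show ?thesis using n by (simp add: reversal_def)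
  next
    case (Cons y u)
    define B where "B = gen_perm x ` gen_interval y"
    have D: "letters id w = {1..n} # B # letters (gen_perm x \<circ> gen_perm y) u"
      using x Cons \<open>w = x # v\<close> by (simp add: B_def)
    then have "B \<noteq> {1..n}" using w by (auto simp: pure_central_def)
    moreover have "B \<subseteq> {1..n}" using pure_central_letters[OF w, of B] D by simp
    ultimately have "avail B (letters id w)" using D by (auto simp: compatible_def)
    then show ?thesis using avail \<open>B \<noteq> {1..n}\<close> by blast
  qed
qed

text \<open>Moving \<open>(1, n)\<close> across \<open>w\<close> applies the full reversal to all
  letters of \<open>w\<close>, while the letter \<open>{1..n}\<close> is central. So with
  \<open>A\<close> its mirror image is available too; but the mirror swaps the two unwanted letters,
  which do not commute.\<close>

lemma central_avail:
  assumes n: "3 \<le> n" and w: "pure_central n w"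
    and commute: "cactus_eq n (gen_word (w @ [(1, n)])) (gen_word ((1, n) # w))"
    and A: "avail A (letters id w)"
  shows "A = {1..n}"
proof -
  let ?r = "reversal 1 n" and ?D = "letters id w" and ?N = "{1..n}"
  let ?D' = "letters (reversal 1 n) w"
  have D': "?D' = map ((`) ?r) ?D" using letters_image[of ?r id w] by simp
  have red: "reduced ?D" "reduced ?D'"
    using w unfolding D' by (simp_all add: pure_central_def reduced_image)
  have "same_action (w @ [(1, n)]) ((1, n) # w)"
    using cactus_eq_same_action[OF commute] by (simp add: comp_def)
  then have "trace_eq (foldr act (letters id (w @ [(1, n)])) []) (foldr act (letters id ((1, n) # w)) [])"
    by (rule same_action_trace) simp_all
  then have 1: "trace_eq (foldr act ?D (act ?N [])) (act ?N ?D')"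
    using w red by (simp add: letters_append pure_central_def foldr_act_reduced)
  have "\<forall>B\<in>set ?D. B = ?N \<or> compatible ?N B"
    using pure_central_letters[OF w] by (auto simp: compatible_def)
  then have 2: "trace_eq (act ?N (foldr act ?D [])) (foldr act ?D (act ?N []))"
    by (rule trace_sym[OF foldr_act_commute])
  have "trace_eq ?D (act ?N (act ?N ?D))" by (rule trace_sym[OF act_act[OF red(1)]])
  also have "trace_eq (act ?N (act ?N ?D)) (act ?N (act ?N ?D'))"
    using trace_trans[OF 2 1] red(1) by (intro act_cong[of "act ?N ?D"]) (simp only: foldr_act_reduced)
  also have "trace_eq (act ?N (act ?N ?D')) ?D'" by (rule act_act[OF red(2)])
  finally have "trace_eq ?D ?D'" .
  then have rA: "avail (?r ` A) ?D"
    using A trace_avail[of ?D ?D' "?r ` A"] unfolding D' by (simp add: avail_image)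
  have r: "?r ` (?N - {a}) = ?N - {?r a}" for a
    using reversal_image_outside[of 1 n ?N] by (simp add: image_set_diff)
  have N: "{1..<1 + n} = ?N" by auto
  have 3: "\<not> compatible (?N - {1}) (?N - {n})" "\<not> compatible (?N - {n}) (?N - {1})"
    using not_compatible_omit[of n 1 1 n] not_compatible_omit[of n n 1 1] n unfolding N by simp_all
  have "n \<in> ?N - {1}" using n by simp
  then have 4: "?N - {1} \<noteq> ?N - {n}" by blast
  have "?r 1 = n" "?r n = 1" using n by (auto simp: reversal_def)
  then have "?r ` (?N - {1}) = ?N - {n}" "?r ` (?N - {n}) = ?N - {1}" using r by metis+
  then show ?thesis
    using pure_central_avail_large[OF n w A] avail_comm[OF A rA] 3 4 by (metis empty_iff insert_iff)
qed

section \<open>From words to group elements\<close>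

abbreviation cactus_class :: "nat \<Rightarrow> (nat \<times> nat) list \<Rightarrow> (nat \<times> nat) word set" where
  "cactus_class n w \<equiv> word_rel (cactus_gens n) (cactus_rels n) `` {gen_word w}"

lemma cactus_class_carrier: "set w \<subseteq> cactus_gens n \<Longrightarrow> cactus_class n w \<in> carrier (cactus_group n)"
  unfolding cactus_group_def by (intro presented_carrierI) simp

lemma cactus_class_mult_eq_iff:
  assumes "set u \<subseteq> cactus_gens n" "set v \<subseteq> cactus_gens n"
  shows "cactus_class n u \<otimes>\<^bsub>cactus_group n\<^esub> cactus_class n v
      = cactus_class n v \<otimes>\<^bsub>cactus_group n\<^esub> cactus_class n u
    \<longleftrightarrow> cactus_eq n (gen_word (u @ v)) (gen_word (v @ u))"
  using assms by (simp add: cactus_group_def presented_mult class_eq_iff)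

lemma cactus_one: "\<one>\<^bsub>cactus_group n\<^esub> = cactus_class n []"
  by (simp add: cactus_group_def presented_one)

lemma cactus_perm_class:
  assumes "set w \<subseteq> cactus_gens n"
  shows "cactus_perm n (cactus_class n w) = list_perm w"
proof -
  have "word_eval (sym_group n) (\<lambda>(p, q). reversal p q) (gen_word w) = list_perm w"
    by (induction w) (auto simp: sym_group_mult sym_group_one)
  then show ?thesis
    unfolding cactus_perm_def
    using presented_hom_class[OF sym_group_is_group reversal_in_sym_group
        reversal_respects_cactus_rels] assms by simp
qed

lemma cactus_carrierE:
  assumes "z \<in> carrier (cactus_group n)"
  obtains w where "set w \<subseteq> cactus_gens n" "reduced (letters id w)" "z = cactus_class n w"
proof -
  obtain v where v: "v \<in> words (cactus_gens n)"
    "z = word_rel (cactus_gens n) (cactus_rels n) `` {v}"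
    using assms unfolding cactus_group_def by (rule presented_carrierE)
  obtain w where "set w \<subseteq> cactus_gens n" "cactus_eq n v (gen_word w)" "reduced (letters id w)"
    using exists_reduced[OF v(1)] .
  with v that show ?thesis by (simp add: class_eq_iff)
qed

lemma one_in_center: "group G \<Longrightarrow> \<one>\<^bsub>G\<^esub> \<in> center G"
  by (simp add: center_def group.is_monoid monoid.l_one monoid.r_one monoid.one_closed)

text \<open>The center of \<open>S_n\<close> is trivial: \<open>f\<close> preserves every pair
  \<open>{k, Suc k}\<close>, an inner position lies in two such pairs, and injectivity settles the
  two ends.\<close>

lemma commutes_with_reversals:
  assumes "3 \<le> n" and f: "inj f" "\<And>i. i \<notin> {1..n} \<Longrightarrow> f i = i"
    and commute: "\<And>p q. 1 \<le> p \<Longrightarrow> p < q \<Longrightarrow> q \<le> n \<Longrightarrow> f \<circ> reversal p q = reversal p q \<circ> f"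
  shows "f = id"
proof
  fix i
  have moved: "f j \<in> {k, Suc k}" if "1 \<le> k" "Suc k \<le> n" "j \<in> {k, Suc k}" for j k
  proof (rule ccontr)
    assume *: "f j \<notin> {k, Suc k}"
    have "f (reversal k (Suc k) j) = reversal k (Suc k) (f j)"
      using fun_cong[OF commute[of k "Suc k"], of j] that by simp
    also have "\<dots> = f j" using * by (auto simp: reversal_def)
    finally have "reversal k (Suc k) j = j" using injD[OF f(1)] by blast
    then show False using that(3) by (auto simp: reversal_def)
  qed
  have inner: "f j = j" if "1 < j" "j < n" for j
    using moved[of "j - 1" j] moved[of j j] that by (cases j) auto
  consider "i \<notin> {1..n}" | "1 < i" "i < n" | "i = 1" | "i = n" by force
  then show "f i = id i"
  proof cases
    case 3
    have "f 1 \<noteq> f 2" using injD[OF f(1), of 1 2] by auto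
    then show ?thesis using 3 moved[of 1 1] inner[of 2] assms(1) by auto
  next
    case 4
    have "f n \<noteq> f (n - 1)" using injD[OF f(1), of n "n - 1"] assms(1) by auto
    then show ?thesis using 4 moved[of "n - 1" n] inner[of "n - 1"] assms(1) by auto
  qed (use f inner in auto)
qed

lemma center_pure_cactus_group:
  assumes n: "3 < n"
  shows "center (pure_cactus_group n) = {\<one>\<^bsub>pure_cactus_group n\<^esub>}"
proof
  show "{\<one>\<^bsub>pure_cactus_group n\<^esub>} \<subseteq> center (pure_cactus_group n)"
    using one_in_center[OF pure_cactus_group_is_group] by simp
  show "center (pure_cactus_group n) \<subseteq> {\<one>\<^bsub>pure_cactus_group n\<^esub>}"
  proof
    fix z assume z: "z \<in> center (pure_cactus_group n)"
    let ?K = "kernel (cactus_group n) (sym_group n) (cactus_perm n)"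
    have zK: "z \<in> ?K" and comm: "\<And>g. g \<in> ?K \<Longrightarrow> z \<otimes>\<^bsub>cactus_group n\<^esub> g = g \<otimes>\<^bsub>cactus_group n\<^esub> z"
      using z by (auto simp: center_def pure_cactus_group_def)
    obtain w where w: "set w \<subseteq> cactus_gens n" "reduced (letters id w)" "z = cactus_class n w"
      using zK by (auto simp: kernel_def elim: cactus_carrierE)
    have perm: "list_perm w = id"
      using zK w by (simp add: kernel_def cactus_perm_class sym_group_one)
    have "cactus_eq n (gen_word (w @ u)) (gen_word (u @ w))"
      if "set u \<subseteq> cactus_gens n" "list_perm u = id" for u
      using comm[of "cactus_class n u"] that w
      by (simp add: kernel_def cactus_class_carrier cactus_perm_class sym_group_one
          cactus_class_mult_eq_iff del: map_append)
    then have "pure_central n w" using w perm by (simp add: pure_central_def)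
    then have "w = []"
      using n by (intro pure_central_Nil[of n] pure_central_avail[of n w]) auto
    then show "z \<in> {\<one>\<^bsub>pure_cactus_group n\<^esub>}"
      using w by (simp add: pure_cactus_group_def cactus_one)
  qed
qed

lemma center_cactus_group:
  assumes n: "2 < n"
  shows "center (cactus_group n) = {\<one>\<^bsub>cactus_group n\<^esub>}"
proof
  show "{\<one>\<^bsub>cactus_group n\<^esub>} \<subseteq> center (cactus_group n)"
    using one_in_center[OF cactus_group_is_group] by simp
  show "center (cactus_group n) \<subseteq> {\<one>\<^bsub>cactus_group n\<^esub>}"
  proof
    fix z assume z: "z \<in> center (cactus_group n)"
    then obtain w where w: "set w \<subseteq> cactus_gens n" "reduced (letters id w)" "z = cactus_class n w"
      by (auto simp: center_def elim: cactus_carrierE)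
    have comm: "cactus_eq n (gen_word (w @ u)) (gen_word (u @ w))"
      if "set u \<subseteq> cactus_gens n" for u
    proof -
      have "z \<otimes>\<^bsub>cactus_group n\<^esub> cactus_class n u = cactus_class n u \<otimes>\<^bsub>cactus_group n\<^esub> z"
        using z cactus_class_carrier[OF that] by (simp add: center_def)
      then show ?thesis using w that by (simp add: cactus_class_mult_eq_iff del: map_append)
    qed
    \<comment> \<open>The permutation of a central element commutes with all reversals, so the
      element is pure.\<close>
    have perm: "list_perm w = id"
    proof (rule commutes_with_reversals[of n])
      show "list_perm w \<circ> reversal p q = reversal p q \<circ> list_perm w"
        if "1 \<le> p" "p < q" "q \<le> n" for p q
      proof -
        have "same_action (w @ [(p, q)]) ([(p, q)] @ w)"
          using cactus_eq_same_action[OF comm[of "[(p, q)]"]] that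
          by (simp add: cactus_gens_def comp_def)
        then show ?thesis by (simp add: same_action_def list_perm_append)
      qed
      show "list_perm w i = i" if "i \<notin> {1..n}" for i
        using that w(1) by (intro list_perm_outside) (fastforce simp: cactus_gens_def)
    qed (use n in auto)
    have "pure_central n w" using w perm comm by (simp add: pure_central_def)
    moreover have "cactus_eq n (gen_word (w @ [(1, n)])) (gen_word ((1, n) # w))"
      using comm[of "[(1, n)]"] n by (simp add: cactus_gens_def)
    ultimately have "w = []"
      using n by (intro pure_central_Nil[of n] central_avail[of n w]) auto
    then show "z \<in> {\<one>\<^bsub>cactus_group n\<^esub>}" using w by (simp add: cactus_one)
  qed
qed

theorem theoremD:
  fixes n :: nat
  shows "(n > 2 \<longrightarrow> center (cactus_group n) = {\<one>\<^bsub>cactus_group n\<^esub>}) \<and>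
         (n > 3 \<longrightarrow> center (pure_cactus_group n) = {\<one>\<^bsub>pure_cactus_group n\<^esub>})"
  by (simp add: center_cactus_group center_pure_cactus_group)

end
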